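(* Let $\mathcal{L}:[0,1]\to[0,1]$ be the Lüroth map. For every $x\in[0,1]$, we have $\mathfrak{m}(\operatorname{LY}_{\mathcal{L}}(x))=1$.
   Context: For $x\in(0,1]$, $a_1(x)$ is the unique integer $\ge 2$ with $\frac{1}{a_1(x)}<x\le\frac{1}{a_1(x)-1}$. The Lüroth map $\mathcal{L}:[0,1]\to[0,1]$ is $\mathcal{L}(x)=a_1(x)(a_1(x)-1)x-(a_1(x)-1)$ for $x\in(0,1]$ and $\mathcal{L}(0)=0$; $\mathcal{L}^n$ is its $n$-th iterate. For $x\in[0,1]$, $\operatorname{LY}_{\mathcal{L}}(x)$ is the set of $y\in[0,1]$ with $y\neq x$ such that $\liminf_{n\to\infty}|\mathcal{L}^n(x)-\mathcal{L}^n(y)|=0$ and $\limsup_{n\to\infty}|\mathcal{L}^n(x)-\mathcal{L}^n(y)|>0$ (Li–Yorke pairs). $\mathfrak{m}$ is Lebesgue measure on $[0,1]$. *)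

theory Defs
  imports "HOL-Analysis.Analysis"
begin

definition luroth_digit :: "real \<Rightarrow> int" where
  "luroth_digit x = (THE a. a \<ge> 2 \<and> 1 / real_of_int a < x \<and> x \<le> 1 / (real_of_int a - 1))"

lemma luroth_digit_iff:
  assumes "0 < x" "x \<le> 1"
  shows "(a \<ge> 2 \<and> 1 / real_of_int a < x \<and> x \<le> 1 / (real_of_int a - 1)) \<longleftrightarrow> a = \<lfloor>1 / x\<rfloor> + 1"
proof -
  have 1: "\<lfloor>1 / x\<rfloor> \<ge> 1" using assms by (simp add: le_floor_iff)
  show ?thesis
  proof (cases "a \<ge> 2")
    case True
    hence a: "real_of_int a \<ge> 2" by simp
    have "1 / real_of_int a < x \<longleftrightarrow> 1 / x < real_of_int a"
      using a assms by (simp add: field_simps)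
    moreover have "x \<le> 1 / (real_of_int a - 1) \<longleftrightarrow> real_of_int a - 1 \<le> 1 / x"
      using a assms by (simp add: field_simps)
    moreover have "a = \<lfloor>1 / x\<rfloor> + 1 \<longleftrightarrow> \<lfloor>1 / x\<rfloor> = a - 1" by linarith
    ultimately show ?thesis using True unfolding floor_eq_iff by auto
  qed (use 1 in auto)
qed

lemma luroth_digit_ex1:
  assumes "0 < x" "x \<le> 1"
  shows "\<exists>!a. a \<ge> 2 \<and> 1 / real_of_int a < x \<and> x \<le> 1 / (real_of_int a - 1)"
  unfolding luroth_digit_iff[OF assms] by simp

lemma luroth_digit:
  assumes "0 < x" "x \<le> 1"
  shows "luroth_digit x \<ge> 2" "1 / real_of_int (luroth_digit x) < x"
    "x \<le> 1 / (real_of_int (luroth_digit x) - 1)"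
  using theI'[OF luroth_digit_ex1[OF assms]] unfolding luroth_digit_def by auto

text \<open>The map is extended by the junk value 0 outside the unit interval.\<close>

definition luroth :: "real \<Rightarrow> real" where
  "luroth x = (if 0 < x \<and> x \<le> 1
     then real_of_int (luroth_digit x) * (real_of_int (luroth_digit x) - 1) * x
            - (real_of_int (luroth_digit x) - 1)
     else 0)"

lemma luroth_in_unit_interval: "luroth x \<in> {0..1}"
proof (cases "0 < x \<and> x \<le> 1")
  case True
  define a where "a = real_of_int (luroth_digit x)"
  have a: "a \<ge> 2" "1 / a < x" "x \<le> 1 / (a - 1)"
    using luroth_digit[of x] True by (auto simp: a_def)
  have "1 \<le> a * x" "(a - 1) * x \<le> 1" using a by (simp_all add: field_simps)
  hence "(a - 1) * 1 \<le> (a - 1) * (a * x)" "a * ((a - 1) * x) \<le> a * 1"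
    using a(1) by (intro mult_left_mono; simp)+
  thus ?thesis using True by (simp add: luroth_def a_def[symmetric] algebra_simps)
qed (auto simp: luroth_def)

text \<open>The limits inferior and superior are taken in the extended reals, since the library's
  \<^const>\<open>liminf\<close> and \<^const>\<open>limsup\<close> require a complete lattice.\<close>

definition li_yorke :: "(real \<Rightarrow> real) \<Rightarrow> real \<Rightarrow> real set" where
  "li_yorke T x = {y \<in> {0..1}. y \<noteq> x \<and>
     liminf (\<lambda>n. ereal \<bar>(T ^^ n) x - (T ^^ n) y\<bar>) = 0 \<and>
     limsup (\<lambda>n. ereal \<bar>(T ^^ n) x - (T ^^ n) y\<bar>) > 0}"

end

theory Submission
  imports Defs
begin

text \<open>A rank \<open>m\<close> cylinder \<open>C\<close> is mapped affinely onto \<open>(0,1]\<close> by the \<open>m\<close>-th iterate, so \<open>C\<close> is independent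
  of every event that depends only on this iterate. Hence the set of \<open>y\<close> whose orbit avoids \<open>C\<close> at
  \<open>k\<close> given times with gaps at least \<open>m\<close> has measure \<open>(1 - |C|)^k\<close>, and so, for any given infinite
  set of times, almost every orbit visits \<open>C\<close> infinitely often at these times. Let the orbit of \<open>x\<close>
  converge to \<open>z\<close> along a subsequence. Along these times almost every orbit visits infinitely often
  arbitrarily small cylinders close to \<open>z\<close>, and also a small cylinder at distance about \<open>1/2\<close> from \<open>z\<close>.\<close>

section \<open>Borel-Lebesgue measure on the half-open unit interval\<close>

text \<open>Omitting \<open>0\<close> costs only a null set. On \<open>{0<..1}\<close> the digit
  cylinders form a partition, and \<open>luroth\<close> maps this interval into itself.\<close>

definition unit_measure :: "real measure" where
  "unit_measure = restrict_space lborel {0<..1}"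

lemma space_unit_measure [simp]: "space unit_measure = {0<..1}"
  by (simp add: unit_measure_def space_restrict_space)

lemma sets_unit_measure: "A \<in> sets unit_measure \<longleftrightarrow> A \<in> sets borel \<and> A \<subseteq> {0<..1}"
  unfolding unit_measure_def by (subst sets_restrict_space_iff) auto

lemma emeasure_unit_measure:
  "A \<subseteq> {0<..1} \<Longrightarrow> emeasure unit_measure A = emeasure lborel A"
  unfolding unit_measure_def by (rule emeasure_restrict_space) auto

lemma measure_unit_measure:
  "A \<subseteq> {0<..1} \<Longrightarrow> measure unit_measure A = measure lborel A"
  by (simp add: measure_def emeasure_unit_measure)

lemma measure_space_unit_measure: "measure unit_measure {0<..1} = 1"
  by (simp add: measure_unit_measure)

interpretation unit_measure: finite_measure unit_measure
  by standard (simp add: emeasure_unit_measure)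

section \<open>Rank one cylinders and the branches of the map\<close>

text \<open>The index \<open>k\<close> stands for the digit \<open>k + 2\<close>, so that all
  naturals occur as indices.\<close>

definition luroth_cylinder :: "nat \<Rightarrow> real set" where
  "luroth_cylinder k = {1 / (real k + 2) <.. 1 / (real k + 1)}"

lemma luroth_cylinder_subset: "luroth_cylinder k \<subseteq> {0<..1}"
proof
  fix x assume x: "x \<in> luroth_cylinder k"
  have "0 < 1 / (real k + 2)" "1 / (real k + 1) \<le> 1" by auto
  thus "x \<in> {0<..1}" using x unfolding luroth_cylinder_def
    unfolding greaterThanAtMost_iff by linarith
qed

lemma luroth_cylinder_measurable: "luroth_cylinder k \<in> sets unit_measure"
  using luroth_cylinder_subset[of k] by (simp add: sets_unit_measure luroth_cylinder_def)

lemma luroth_cylinder_digit: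
  assumes "0 < x" "x \<le> 1"
  shows "x \<in> luroth_cylinder k \<longleftrightarrow> luroth_digit x = int k + 2"
  using luroth_digit_iff[OF assms, of "int k + 2"] luroth_digit_iff[OF assms, of "luroth_digit x"]
    luroth_digit[OF assms]
  by (auto simp: luroth_cylinder_def algebra_simps)

lemma luroth_on_cylinder:
  assumes "x \<in> luroth_cylinder k"
  shows "luroth x = (real k + 2) * (real k + 1) * x - (real k + 1)"
proof -
  have x: "0 < x" "x \<le> 1" using assms luroth_cylinder_subset[of k] by auto
  have "luroth_digit x = int k + 2" using luroth_cylinder_digit[OF x] assms by simp
  thus ?thesis using x by (simp add: luroth_def)
qed

lemma luroth_cylinder_exists:
  assumes "x \<in> {0<..1}"
  obtains k where "x \<in> luroth_cylinder k"
proof -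
  have x: "0 < x" "x \<le> 1" using assms by auto
  have "x \<in> luroth_cylinder (nat (luroth_digit x - 2))"
    using luroth_cylinder_digit[OF x] luroth_digit(1)[OF x] by simp
  thus thesis by (rule that)
qed

lemma disjoint_luroth_cylinder: "disjoint_family luroth_cylinder"
  unfolding disjoint_family_on_def
proof (intro ballI impI equals0I)
  fix i j :: nat and x assume "i \<noteq> j" "x \<in> luroth_cylinder i \<inter> luroth_cylinder j"
  moreover have "0 < x" "x \<le> 1" using calculation luroth_cylinder_subset[of i] by auto
  ultimately show False using luroth_cylinder_digit[of x] by auto
qed

text \<open>The open left endpoint of a cylinder makes the image strictly positive, so orbits
  starting in \<open>{0<..1}\<close> never hit \<open>0\<close>.\<close>

lemma luroth_range:
  assumes "x \<in> {0<..1}"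
  shows "luroth x \<in> {0<..1}"
proof -
  obtain k where k: "x \<in> luroth_cylinder k" using luroth_cylinder_exists[OF assms] .
  hence "1 < (real k + 2) * x" by (simp add: luroth_cylinder_def field_simps)
  hence "(real k + 1) * 1 < (real k + 1) * ((real k + 2) * x)" by (intro mult_strict_left_mono) auto
  thus ?thesis using luroth_in_unit_interval[of x] luroth_on_cylinder[OF k] by (simp add: algebra_simps)
qed

lemma luroth_iterate_range: "x \<in> {0<..1} \<Longrightarrow> (luroth ^^ n) x \<in> {0<..1}"
  by (induction n) (use luroth_range in auto)

lemma luroth_iterate_unit_interval: "x \<in> {0..1} \<Longrightarrow> (luroth ^^ n) x \<in> {0..1}"
  by (induction n) (use luroth_in_unit_interval in auto)

text \<open>On \<open>{0<..1}\<close> the digit is \<open>floor (1/x) + 1\<close>, which replaces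
  the definite description by an explicit Borel expression.\<close>

lemma luroth_measurable: "luroth \<in> unit_measure \<rightarrow>\<^sub>M unit_measure"
proof -
  have "(\<lambda>x. (of_int \<lfloor>1 / x\<rfloor> + 1) * of_int \<lfloor>1 / x\<rfloor> * x - of_int \<lfloor>1 / x\<rfloor> :: real)
      \<in> borel_measurable unit_measure"
    unfolding unit_measure_def by (intro measurable_restrict_space1) measurable
  moreover have "luroth x = (of_int \<lfloor>1 / x\<rfloor> + 1) * of_int \<lfloor>1 / x\<rfloor> * x - of_int \<lfloor>1 / x\<rfloor>"
    if "x \<in> space unit_measure" for x
    using that luroth_digit_iff[of x "luroth_digit x"] luroth_digit[of x]
    by (auto simp: luroth_def)
  ultimately have "luroth \<in> borel_measurable unit_measure"
    using measurable_cong by (metis (no_types, lifting))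
  hence "luroth \<in> unit_measure \<rightarrow>\<^sub>M restrict_space borel {0<..1}"
    by (rule measurable_restrict_space2[rotated]) (use luroth_range in auto)
  moreover have "sets (restrict_space borel {0<..1}) = sets unit_measure"
    unfolding unit_measure_def by (rule sets_restrict_space_cong) simp
  ultimately show ?thesis using measurable_cong_sets by blast
qed

lemma luroth_iterate_measurable: "(luroth ^^ n) \<in> unit_measure \<rightarrow>\<^sub>M unit_measure"
proof (induction n)
  case (Suc n)
  show ?case using measurable_comp[OF Suc luroth_measurable] unfolding funpow.simps .
qed (simp add: id_def)

section \<open>Invariance of the measure and independence\<close>

definition luroth_preimage :: "nat \<Rightarrow> real set \<Rightarrow> real set" where
  "luroth_preimage n G = (luroth ^^ n) -` G \<inter> {0<..1}"

lemma luroth_preimage_measurable: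
  "G \<in> sets unit_measure \<Longrightarrow> luroth_preimage n G \<in> sets unit_measure"
  using measurable_sets[OF luroth_iterate_measurable] by (simp add: luroth_preimage_def)

lemma luroth_preimage_add:
  "luroth_preimage (m + n) G = luroth_preimage m (luroth_preimage n G)"
proof -
  have "(luroth ^^ (m + n)) x = (luroth ^^ n) ((luroth ^^ m) x)" for x
    by (subst add.commute) (simp add: funpow_add)
  thus ?thesis using luroth_iterate_range by (auto simp: luroth_preimage_def)
qed

text \<open>Takes the place of "rank \<open>m\<close> cylinder", so that digit words need no
  encoding: \<open>C\<close> is independent of all events determined by the \<open>m\<close>-th
  iterate. By invariance of the measure, \<open>G\<close> and its preimage have the same measure,
  hence the factor for \<open>G\<close> itself.\<close>

definition independent_of_future :: "nat \<Rightarrow> real set \<Rightarrow> bool" where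
  "independent_of_future m C \<longleftrightarrow> C \<in> sets unit_measure \<and>
     (\<forall>G \<in> sets unit_measure. measure unit_measure (C \<inter> luroth_preimage m G) =
        measure unit_measure C * measure unit_measure G)"

text \<open>The inverse branch \<open>t + c * x\<close> carries \<open>{0<..1}\<close> onto the
  cylinder and \<open>G\<close> onto the set in question, scaling Lebesgue measure by
  \<open>c\<close>.\<close>

lemma measure_luroth_cylinder_preimage:
  assumes G: "G \<in> sets unit_measure"
  shows "measure unit_measure (luroth_cylinder k \<inter> luroth_preimage 1 G) =
    measure unit_measure G / ((real k + 2) * (real k + 1))"
proof -
  \<comment> \<open>\<open>c\<close> is the length of the cylinder and \<open>t\<close> its left
    endpoint.\<close>
  define c where "c = 1 / ((real k + 2) * (real k + 1))"
  define t where "t = 1 / (real k + 2)"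
  have c: "c > 0" unfolding c_def by (intro divide_pos_pos mult_pos_pos) auto
  have c_nz: "real k + 2 \<noteq> 0" "real k + 1 \<noteq> 0" by linarith+
  have endpoint: "t + c = 1 / (real k + 1)" 
  proof -
    show ?thesis using c_nz unfolding t_def c_def by (simp add: divide_simps)
  qed
  have cyl: "t + c * x \<in> luroth_cylinder k \<longleftrightarrow> x \<in> {0<..1}" for x
  proof -
    have "t + c * x \<le> t + c \<longleftrightarrow> x \<le> 1" using c by simp
    thus ?thesis using c endpoint by (simp add: luroth_cylinder_def t_def[symmetric] zero_less_mult_iff)
  qed
  have inv: "luroth (t + c * x) = x" if "x \<in> {0<..1}" for x
  proof -
    have "t + c * x \<in> luroth_cylinder k" using cyl that by blast
    hence "luroth (t + c * x) = (real k + 2) * (real k + 1) * (t + c * x) - (real k + 1)"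
      by (rule luroth_on_cylinder)
    also have "\<dots> = (real k + 1) * ((real k + 2) * t) + (real k + 2) * (real k + 1) * c * x - (real k + 1)"
      by (simp add: algebra_simps)
    also have "(real k + 2) * t = 1" using c_nz by (simp add: t_def)
    also have "(real k + 2) * (real k + 1) * c = 1" using c_nz by (simp add: c_def)
    finally have "luroth (t + c * x) = (real k + 1) * 1 + 1 * x - (real k + 1)" .
    also have "\<dots> = x" by simp
    finally show ?thesis .
  qed
  define A where "A = luroth_cylinder k \<inter> luroth_preimage 1 G"
  have A: "A \<in> sets unit_measure"
    unfolding A_def using luroth_cylinder_measurable luroth_preimage_measurable[OF G] by blast
  have "(\<lambda>x. t + c * x) -` A = G"
  proof -
    have "t + c * x \<in> A \<longleftrightarrow> x \<in> {0<..1} \<and> luroth (t + c * x) \<in> G" for x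
      using cyl[of x] luroth_cylinder_subset[of k] unfolding A_def luroth_preimage_def by auto
    moreover have "x \<in> {0<..1} \<and> luroth (t + c * x) \<in> G \<longleftrightarrow> x \<in> G" for x
      using inv[of x] G unfolding sets_unit_measure by auto
    ultimately show ?thesis by blast
  qed
  moreover have "emeasure lborel A = ennreal c * emeasure lborel ((\<lambda>x. t + c * x) -` A)"
  proof -
    have "emeasure lborel A = emeasure (density (distr lborel borel (\<lambda>x. t + c * x)) (\<lambda>_. ennreal c)) A"
      using lborel_real_affine[of c t] c by simp
    also have "\<dots> = ennreal c * emeasure lborel ((\<lambda>x. t + c * x) -` A)"
      using A by (simp add: emeasure_density_const emeasure_distr sets_unit_measure)
    finally show ?thesis .
  qed
  ultimately have "measure lborel A = c * measure lborel G"
    using c by (simp add: measure_def enn2real_mult)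
  thus ?thesis using A G unfolding A_def[symmetric]
    by (simp add: measure_unit_measure sets_unit_measure c_def)
qed

lemma measure_luroth_cylinder:
  "measure unit_measure (luroth_cylinder k) = 1 / ((real k + 2) * (real k + 1))"
proof -
  have "luroth_cylinder k \<inter> luroth_preimage 1 {0<..1} = luroth_cylinder k"
    using luroth_range luroth_cylinder_subset[of k] by (auto simp: luroth_preimage_def)
  thus ?thesis using measure_luroth_cylinder_preimage[of "{0<..1}" k]
    by (simp add: sets_unit_measure measure_space_unit_measure)
qed

text \<open>For one step, each cylinder contributes its length times the measure of the target, and
  the lengths add up to 1.\<close>

lemma measure_luroth_preimage:
  assumes "G \<in> sets unit_measure"
  shows "measure unit_measure (luroth_preimage n G) = measure unit_measure G"
proof (induction n)
  case 0
  have "luroth_preimage 0 G = G" using assms by (auto simp: luroth_preimage_def sets_unit_measure)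
  thus ?case by simp
next
  case (Suc n)
  define H where "H = luroth_preimage n G"
  have H: "H \<in> sets unit_measure" using luroth_preimage_measurable[OF assms] by (simp add: H_def)
  define B where "B = (\<lambda>k. luroth_cylinder k \<inter> luroth_preimage 1 H)"
  have cov: "(\<Union>k. luroth_cylinder k) = {0<..1}"
  proof
    show "(\<Union>k. luroth_cylinder k) \<subseteq> {0<..1}" using luroth_cylinder_subset by (rule UN_least)
    show "{0<..1} \<subseteq> (\<Union>k. luroth_cylinder k)"
    proof
      fix x :: real assume "x \<in> {0<..1}"
      then obtain k where "x \<in> luroth_cylinder k" by (rule luroth_cylinder_exists)
      thus "x \<in> (\<Union>k. luroth_cylinder k)" by blast
    qed
  qed
  \<comment> \<open>The series of lengths is summed by countable additivity over the partition
    instead of by telescoping.\<close>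
  have "(\<lambda>k. measure unit_measure (luroth_cylinder k)) sums measure unit_measure (\<Union>k. luroth_cylinder k)"
    by (rule unit_measure.finite_measure_UNION)
       (use luroth_cylinder_measurable disjoint_luroth_cylinder in auto)
  hence "(\<lambda>k. 1 / ((real k + 2) * (real k + 1))) sums 1"
    by (simp only: cov measure_luroth_cylinder measure_space_unit_measure)
  hence "(\<lambda>k. 1 / ((real k + 2) * (real k + 1)) * measure unit_measure H) sums (1 * measure unit_measure H)"
    by (rule sums_mult2)
  hence "(\<lambda>k. measure unit_measure (B k)) sums measure unit_measure H"
    by (simp add: B_def measure_luroth_cylinder_preimage[OF H] del: One_nat_def)
  moreover have "(\<lambda>k. measure unit_measure (B k)) sums measure unit_measure (\<Union>k. B k)"
  proof (rule unit_measure.finite_measure_UNION)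
    show "range B \<subseteq> sets unit_measure"
      using luroth_cylinder_measurable luroth_preimage_measurable[OF H] by (auto simp: B_def)
    show "disjoint_family B"
      using disjoint_luroth_cylinder unfolding B_def disjoint_family_on_def by blast
  qed
  moreover have "(\<Union>k. B k) = luroth_preimage 1 H"
    using cov by (auto simp: B_def luroth_preimage_def)
  ultimately have "measure unit_measure (luroth_preimage 1 H) = measure unit_measure H"
    using sums_unique2 by metis
  thus ?case using Suc luroth_preimage_add[of 1 n G] by (simp add: H_def)
qed

text \<open>Prefixing one digit raises the rank by one: the one-step formula is applied to
  \<open>C\<close> intersected with the \<open>m\<close>-step preimage of \<open>G\<close>, whose
  measure factors by hypothesis.\<close>

lemma independent_of_future_cylinder:
  assumes "independent_of_future m C"
  shows "independent_of_future (Suc m) (luroth_cylinder k \<inter> luroth_preimage 1 C)"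
    and "measure unit_measure (luroth_cylinder k \<inter> luroth_preimage 1 C) =
      measure unit_measure C / ((real k + 2) * (real k + 1))"
proof -
  have C: "C \<in> sets unit_measure" using assms by (simp add: independent_of_future_def)
  show 1: "measure unit_measure (luroth_cylinder k \<inter> luroth_preimage 1 C) =
      measure unit_measure C / ((real k + 2) * (real k + 1))"
    by (rule measure_luroth_cylinder_preimage[OF C])
  show "independent_of_future (Suc m) (luroth_cylinder k \<inter> luroth_preimage 1 C)"
    unfolding independent_of_future_def
  proof (intro conjI ballI)
    show "luroth_cylinder k \<inter> luroth_preimage 1 C \<in> sets unit_measure"
      using luroth_cylinder_measurable luroth_preimage_measurable[OF C] by blast
    fix G assume G: "G \<in> sets unit_measure"
    have "luroth_cylinder k \<inter> luroth_preimage 1 C \<inter> luroth_preimage (Suc m) G =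
        luroth_cylinder k \<inter> luroth_preimage 1 (C \<inter> luroth_preimage m G)"
      using luroth_preimage_add[of 1 m G] by (auto simp: luroth_preimage_def)
    moreover have "C \<inter> luroth_preimage m G \<in> sets unit_measure"
      using C luroth_preimage_measurable[OF G] by blast
    moreover have "measure unit_measure (C \<inter> luroth_preimage m G) =
        measure unit_measure C * measure unit_measure G"
      using assms G by (simp add: independent_of_future_def)
    ultimately show "measure unit_measure
        (luroth_cylinder k \<inter> luroth_preimage 1 C \<inter> luroth_preimage (Suc m) G) =
        measure unit_measure (luroth_cylinder k \<inter> luroth_preimage 1 C) * measure unit_measure G"
      unfolding 1 by (simp add: measure_luroth_cylinder_preimage del: One_nat_def)
  qed
qed

text \<open>Induction prefixes the digit of \<open>z\<close> to a cylinder around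
  \<open>luroth z\<close>. Every branch has slope at least 2, so the diameter bound halves each
  time.\<close>

lemma small_cylinder:
  assumes "z \<in> {0<..1}"
  shows "\<exists>C. independent_of_future m C \<and> z \<in> C \<and> measure unit_measure C > 0 \<and>
    (\<forall>u\<in>C. \<forall>v\<in>C. \<bar>u - v\<bar> \<le> (1/2) ^ m)"
  using assms
proof (induction m arbitrary: z)
  case 0
  have "{0<..1} \<inter> luroth_preimage 0 G = G" if "G \<in> sets unit_measure" for G
    using that by (auto simp: luroth_preimage_def sets_unit_measure)
  hence "independent_of_future 0 {0<..1}"
    unfolding independent_of_future_def measure_space_unit_measure
    by (simp add: sets_unit_measure)
  thus ?case using 0 by (intro exI[of _ "{0<..1}"]) (auto simp: measure_space_unit_measure)
next
  case (Suc m)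
  obtain C where C: "independent_of_future m C" "luroth z \<in> C" "measure unit_measure C > 0"
      "\<And>u v. u \<in> C \<Longrightarrow> v \<in> C \<Longrightarrow> \<bar>u - v\<bar> \<le> (1/2) ^ m"
    using Suc.IH[OF luroth_range[OF Suc.prems]] by blast
  obtain k where k: "z \<in> luroth_cylinder k" using luroth_cylinder_exists[OF Suc.prems] .
  let ?D = "luroth_cylinder k \<inter> luroth_preimage 1 C"
  have "\<bar>u - v\<bar> \<le> (1/2) ^ Suc m" if "u \<in> ?D" "v \<in> ?D" for u v
  proof -
    have "luroth u - luroth v = (real k + 2) * (real k + 1) * (u - v)"
      using that luroth_on_cylinder[of u k] luroth_on_cylinder[of v k] by (simp add: right_diff_distrib)
    hence "(real k + 2) * (real k + 1) * \<bar>u - v\<bar> = \<bar>luroth u - luroth v\<bar>"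
      by (simp add: abs_mult)
    also have "\<dots> \<le> (1/2) ^ m" using that C(4) by (simp add: luroth_preimage_def)
    finally have *: "(real k + 2) * (real k + 1) * \<bar>u - v\<bar> \<le> (1/2) ^ m" .
    \<comment> \<open>The smallest slope is 2, attained at \<open>k = 0\<close>.\<close>
    have "2 * 1 \<le> (real k + 2) * (real k + 1)" by (rule mult_mono) auto
    hence "2 * \<bar>u - v\<bar> \<le> (real k + 2) * (real k + 1) * \<bar>u - v\<bar>"
      by (intro mult_right_mono) auto
    thus ?thesis using * by simp
  qed
  moreover have "z \<in> ?D" using k C(2) Suc.prems by (simp add: luroth_preimage_def)
  moreover have "measure unit_measure ?D > 0"
    unfolding independent_of_future_cylinder(2)[OF C(1)] using C(3) by simp
  ultimately show ?case using independent_of_future_cylinder(1)[OF C(1)] by blast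
qed

section \<open>Visits of almost every orbit to a cylinder\<close>

text \<open>\<open>F j k\<close> counts time from \<open>s j\<close>, so its first condition
  concerns \<open>y\<close> itself. Removing that condition leaves the preimage of
  \<open>F (Suc j) k\<close>; hence \<open>j\<close> must be arbitrary in the induction on
  \<open>k\<close>.\<close>

lemma measure_avoiding_orbits:
  fixes s :: "nat \<Rightarrow> nat"
  assumes C: "independent_of_future m C" and gap: "\<And>j. s j + m \<le> s (Suc j)"
  defines "F \<equiv> \<lambda>j k. {y \<in> {0<..1}. \<forall>i<k. (luroth ^^ (s (j + i) - s j)) y \<notin> C}"
  shows "F j k \<in> sets unit_measure \<and> measure unit_measure (F j k) = (1 - measure unit_measure C) ^ k"
proof (induction k arbitrary: j)
  case 0
  have "F j 0 = {0<..1}" by (auto simp: F_def)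
  thus ?case by (simp add: sets_unit_measure measure_space_unit_measure)
next
  case (Suc k)
  have Cs: "C \<in> sets unit_measure" using C by (simp add: independent_of_future_def)
  have mono: "s a \<le> s b" if "a \<le> b" for a b
    using lift_Suc_mono_le[of s a b] gap that by (meson add_leD1)
  \<comment> \<open>The step from \<open>s j\<close> to the next time splits into \<open>m\<close>
    iterates, handled by independence of \<open>C\<close>, and \<open>p\<close> further ones,
    handled by invariance.\<close>
  define p where "p = s (Suc j) - s j - m"
  have p: "s (Suc j) - s j = m + p" using gap[of j] by (simp add: p_def)
  define G where "G = luroth_preimage p (F (Suc j) k)"
  have G: "G \<in> sets unit_measure" "measure unit_measure G = (1 - measure unit_measure C) ^ k"
    using Suc[of "Suc j"] luroth_preimage_measurable measure_luroth_preimage by (simp_all add: G_def)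
  have P: "luroth_preimage m G \<in> sets unit_measure" using luroth_preimage_measurable[OF G(1)] .
  have "F j (Suc k) = luroth_preimage m G - C \<inter> luroth_preimage m G"
  proof -
    have "(luroth ^^ (s (j + Suc i) - s j)) y =
        (luroth ^^ (s (Suc j + i) - s (Suc j))) ((luroth ^^ (m + p)) y)" for i y
    proof -
      have "s (j + Suc i) - s j = (s (Suc j + i) - s (Suc j)) + (m + p)"
        using mono[of "Suc j" "Suc j + i"] mono[of j "Suc j"] p by simp
      thus ?thesis by (simp only: funpow_add o_apply)
    qed
    moreover have "luroth_preimage m G = luroth_preimage (m + p) (F (Suc j) k)"
      by (simp add: G_def luroth_preimage_add)
    ultimately show ?thesis
      using luroth_iterate_range[of _ "m + p"]
      unfolding F_def All_less_Suc2 luroth_preimage_def by auto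
  qed
  moreover have "measure unit_measure (luroth_preimage m G - C \<inter> luroth_preimage m G) =
      measure unit_measure (luroth_preimage m G) - measure unit_measure (C \<inter> luroth_preimage m G)"
    using P Cs by (intro unit_measure.finite_measure_Diff) auto
  moreover have "measure unit_measure (C \<inter> luroth_preimage m G) =
      measure unit_measure C * measure unit_measure G"
    using C G by (simp add: independent_of_future_def)
  ultimately show ?case
    using P Cs G by (auto simp: measure_luroth_preimage algebra_simps)
qed

text \<open>Orbits that avoid \<open>C\<close> at all chosen times from some index on lie in sets of
  measure at most \<open>(1 - |C|)^k\<close> for every \<open>k\<close>. There are only countably
  many starting indices.\<close>

lemma AE_infinitely_often:
  fixes r :: "nat \<Rightarrow> nat"
  assumes r: "strict_mono r" and C: "independent_of_future m C" and pos: "measure unit_measure C > 0"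
  shows "AE y in unit_measure. \<exists>\<^sub>\<infinity>j. (luroth ^^ r j) y \<in> C"
proof -
  \<comment> \<open>Thinning a strictly increasing sequence produces the required gaps. The factor
    \<open>Suc m\<close>, not \<open>m\<close>, keeps \<open>s\<close> a genuine subsequence when
    \<open>m = 0\<close>.\<close>
  define s where "s j = r (j * Suc m)" for j
  have gap: "s j + m \<le> s (Suc j)" for j
  proof -
    have shift: "r a + b \<le> r (a + b)" for a b
    proof (induction b)
      case (Suc b)
      have "r (a + b) < r (a + Suc b)" using strict_monoD[OF r] by simp
      thus ?case using Suc by simp
    qed simp
    have "r (j * Suc m) + m \<le> r (j * Suc m + m)" by (rule shift)
    also have "\<dots> \<le> r (Suc j * Suc m)" using strict_mono_mono[OF r] by (intro monoD[of r]) auto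
    finally show ?thesis by (simp only: s_def)
  qed
  have mono: "s a \<le> s b" if "a \<le> b" for a b
    using lift_Suc_mono_le[of s a b] gap that by (meson add_leD1)
  define F where "F j k = {y \<in> {0<..1}. \<forall>i<k. (luroth ^^ (s (j + i) - s j)) y \<notin> C}" for j k
  have F: "F j k \<in> sets unit_measure" "measure unit_measure (F j k) = (1 - measure unit_measure C) ^ k" for j k
    using measure_avoiding_orbits[OF C, of s, OF gap] unfolding F_def by blast+
  have "AE y in unit_measure. \<exists>i\<ge>j. (luroth ^^ s i) y \<in> C" for j
  proof -
    \<comment> \<open>The preimage under \<open>s j\<close> iterates converts the times relative to
      \<open>s j\<close> into absolute ones, without changing the measure.\<close>
    define Z where "Z = (\<Inter>k. luroth_preimage (s j) (F j k))"
    have Z: "Z \<in> sets unit_measure"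
      unfolding Z_def using luroth_preimage_measurable[OF F(1)] by auto
    have "measure unit_measure Z \<le> (1 - measure unit_measure C) ^ k" for k
    proof -
      have "measure unit_measure Z \<le> measure unit_measure (luroth_preimage (s j) (F j k))"
        using luroth_preimage_measurable[OF F(1)] 
        by (intro unit_measure.finite_measure_mono) (auto simp: Z_def)
      thus ?thesis by (simp add: measure_luroth_preimage[OF F(1)] F(2))
    qed
    moreover have "(\<lambda>k. (1 - measure unit_measure C) ^ k) \<longlonglongrightarrow> 0"
    proof (rule LIMSEQ_power_zero)
      have "measure unit_measure C \<le> 1"
        using unit_measure.bounded_measure[of C] by (simp add: measure_space_unit_measure)
      thus "norm (1 - measure unit_measure C) < 1" using pos by simp
    qed
    ultimately have "measure unit_measure Z \<le> 0" by (intro LIMSEQ_le_const) auto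
    hence "Z \<in> null_sets unit_measure"
      using Z measure_nonneg[of unit_measure Z]
      by (intro null_setsI) (simp_all add: unit_measure.emeasure_eq_measure)
    moreover have "{y \<in> space unit_measure. \<not> (\<exists>i\<ge>j. (luroth ^^ s i) y \<in> C)} \<subseteq> Z"
    proof clarsimp
      fix y assume y: "0 < y" "y \<le> 1" "\<forall>i\<ge>j. (luroth ^^ s i) y \<notin> C"
      have "(luroth ^^ (s (j + i) - s j)) ((luroth ^^ s j) y) \<notin> C" for i
      proof -
        have "(luroth ^^ (s (j + i) - s j)) ((luroth ^^ s j) y) = (luroth ^^ (s (j + i) - s j + s j)) y"
          by (simp only: funpow_add o_apply)
        thus ?thesis using mono[of j "j + i"] y(3) by simp
      qed
      thus "y \<in> Z"
        using y luroth_iterate_range[of y "s j"] by (simp add: Z_def luroth_preimage_def F_def)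
    qed
    ultimately show ?thesis by (intro AE_I') auto
  qed
  hence "AE y in unit_measure. \<forall>j. \<exists>i\<ge>j. (luroth ^^ s i) y \<in> C" by (simp add: AE_all_countable)
  thus ?thesis
  proof (rule AE_mp, intro AE_I2 impI)
    fix y assume y: "\<forall>j. \<exists>i\<ge>j. (luroth ^^ s i) y \<in> C"
    show "\<exists>\<^sub>\<infinity>j. (luroth ^^ r j) y \<in> C"
      unfolding INFM_nat_le
    proof
      fix j
      obtain i where "i \<ge> j" "(luroth ^^ s i) y \<in> C" using y by blast
      moreover from this have "i * Suc m \<ge> j" by simp
      ultimately show "\<exists>i\<ge>j. (luroth ^^ r i) y \<in> C" unfolding s_def by blast
    qed
  qed
qed

text \<open>The target \<open>w\<close> may be \<open>0\<close>, which lies in no cylinder. It is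
  therefore replaced by a positive point \<open>z\<close> within \<open>e / 2\<close>, and a
  cylinder around \<open>z\<close> of diameter below \<open>e / 2\<close> is used.\<close>

lemma AE_infinitely_often_close:
  fixes r :: "nat \<Rightarrow> nat"
  assumes "strict_mono r" "w \<in> {0..1}" "e > 0"
  shows "AE y in unit_measure. \<exists>\<^sub>\<infinity>j. \<bar>(luroth ^^ r j) y - w\<bar> < e"
proof -
  define z where "z = max w (min 1 (e / 2))"
  have z: "z \<in> {0<..1}" "\<bar>z - w\<bar> \<le> e / 2" using assms by (auto simp: z_def)
  obtain m where m: "(1/2) ^ m < e / 2"
    using real_arch_pow_inv[of "e / 2" "1/2"] assms(3) by auto
  obtain C where C: "independent_of_future m C" "z \<in> C" "measure unit_measure C > 0"
      "\<And>u v. u \<in> C \<Longrightarrow> v \<in> C \<Longrightarrow> \<bar>u - v\<bar> \<le> (1/2) ^ m"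
    using small_cylinder[OF z(1)] by blast
  have "\<bar>u - w\<bar> < e" if "u \<in> C" for u using C(4)[OF that C(2)] z(2) m by linarith
  thus ?thesis
    using AE_infinitely_often[OF assms(1) C(1,3)] by (elim eventually_mono INFM_mono) blast
qed

section \<open>Li-Yorke pairs\<close>

lemma INFM_strict_mono:
  fixes r :: "nat \<Rightarrow> nat"
  assumes "strict_mono r" "\<exists>\<^sub>\<infinity>j. P (r j)"
  shows "\<exists>\<^sub>\<infinity>n. P n"
  unfolding INFM_nat_le
proof
  fix N
  obtain j where "j \<ge> N" "P (r j)" using assms(2) unfolding INFM_nat_le by blast
  thus "\<exists>n\<ge>N. P n" using strict_mono_imp_increasing[OF assms(1), of j] le_trans by blast
qed

text \<open>The subsequence \<open>r\<close> and its limit \<open>z\<close> come from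
  \<open>x\<close> alone, before \<open>y\<close> is chosen, so the almost sure visits can be
  requested at the times \<open>r j\<close>.\<close>

lemma AE_li_yorke_luroth:
  assumes "x \<in> {0..1}"
  shows "AE y in unit_measure. y \<in> li_yorke luroth x"
proof -
  have "\<forall>n. (luroth ^^ n) x \<in> {0..1}" using luroth_iterate_unit_interval[OF assms] by blast
  then obtain z r where z: "z \<in> {0..1}" and r: "strict_mono (r :: nat \<Rightarrow> nat)"
    and "((\<lambda>n. (luroth ^^ n) x) \<circ> r) \<longlonglongrightarrow> z"
    by (rule seq_compactE[OF compact_imp_seq_compact[OF compact_Icc]])
  hence lim: "\<forall>\<^sub>\<infinity>j. \<bar>(luroth ^^ r j) x - z\<bar> < e" if "e > 0" for e
    using that unfolding tendsto_iff dist_real_def o_def cofinite_eq_sequentially by blast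
  \<comment> \<open>The endpoint of the unit interval farther from \<open>z\<close>.\<close>
  define w where "w = (if z \<le> 1/2 then 1 else 0 :: real)"
  have w: "w \<in> {0..1}" "\<bar>w - z\<bar> \<ge> 1/2" using z by (auto simp: w_def)
  \<comment> \<open>Countably many radii suffice, so one null set serves all of them.\<close>
  have near: "AE y in unit_measure. \<forall>k. \<exists>\<^sub>\<infinity>j. \<bar>(luroth ^^ r j) y - z\<bar> < inverse (real (Suc k))"
    unfolding AE_all_countable using AE_infinitely_often_close[OF r z] by simp
  have far: "AE y in unit_measure. \<exists>\<^sub>\<infinity>j. \<bar>(luroth ^^ r j) y - w\<bar> < 1/8"
    using AE_infinitely_often_close[OF r w(1), of "1/8"] by simp
  show ?thesis using near far AE_space
  proof eventually_elim
    case (elim y)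
    define d where "d n = \<bar>(luroth ^^ n) x - (luroth ^^ n) y\<bar>" for n
    have small: "\<exists>\<^sub>\<infinity>n. d n < e" if e: "e > 0" for e
    proof (rule INFM_strict_mono[OF r])
      obtain k where k: "inverse (real (Suc k)) < e / 2"
        using reals_Archimedean[OF half_gt_zero[OF e]] by blast
      \<comment> \<open>Infinitely many good times for \<open>y\<close> meet the cofinitely many
        good times for \<open>x\<close>.\<close>
      have "\<exists>\<^sub>\<infinity>j. \<bar>(luroth ^^ r j) y - z\<bar> < inverse (real (Suc k)) \<and> \<bar>(luroth ^^ r j) x - z\<bar> < e / 2"
        using elim(1) lim[OF half_gt_zero[OF e]] by (intro INFM_conjI) blast+
      thus "\<exists>\<^sub>\<infinity>j. d (r j) < e"
      proof (rule INFM_mono)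
        fix j assume "\<bar>(luroth ^^ r j) y - z\<bar> < inverse (real (Suc k)) \<and> \<bar>(luroth ^^ r j) x - z\<bar> < e / 2"
        thus "d (r j) < e" using k unfolding d_def by linarith
      qed
    qed
    \<comment> \<open>The bound is \<open>1/2 - 1/8 - 1/8\<close>: the distance from
      \<open>w\<close> to \<open>z\<close> less the two errors.\<close>
    have large: "\<exists>\<^sub>\<infinity>n. d n > 1/4"
    proof (rule INFM_strict_mono[OF r])
      have "\<exists>\<^sub>\<infinity>j. \<bar>(luroth ^^ r j) y - w\<bar> < 1/8 \<and> \<bar>(luroth ^^ r j) x - z\<bar> < 1/8"
        using elim(2) lim[of "1/8"] by (intro INFM_conjI) simp_all
      thus "\<exists>\<^sub>\<infinity>j. d (r j) > 1/4"
      proof (rule INFM_mono)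
        fix j assume "\<bar>(luroth ^^ r j) y - w\<bar> < 1/8 \<and> \<bar>(luroth ^^ r j) x - z\<bar> < 1/8"
        thus "d (r j) > 1/4" using w(2) unfolding d_def by linarith
      qed
    qed
    have "\<exists>n. d n > 1/4" using large by (rule INFM_E) blast
    hence "y \<noteq> x" by (auto simp: d_def)
    moreover have "liminf (\<lambda>n. ereal (d n)) = 0"
    proof (rule antisym)
      show "0 \<le> liminf (\<lambda>n. ereal (d n))" by (intro Liminf_bounded) (simp add: d_def)
      show "liminf (\<lambda>n. ereal (d n)) \<le> 0"
      proof (rule ccontr)
        assume "\<not> liminf (\<lambda>n. ereal (d n)) \<le> 0"
        hence "0 < liminf (\<lambda>n. ereal (d n))" by (simp only: not_le)
        then obtain e where e: "0 < ereal e" "ereal e < liminf (\<lambda>n. ereal (d n))"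
          using ereal_dense2 by blast
        from e(2) have "\<forall>\<^sub>F n in sequentially. ereal e < ereal (d n)" by (rule less_LiminfD)
        hence "\<forall>\<^sub>\<infinity>n. \<not> d n < e"
          unfolding cofinite_eq_sequentially by (rule eventually_mono) simp
        thus False using small[of e] e(1) by (simp add: frequently_def)
      qed
    qed
    moreover have "limsup (\<lambda>n. ereal (d n)) > 0"
    proof (rule ccontr)
      assume "\<not> limsup (\<lambda>n. ereal (d n)) > 0"
      hence "limsup (\<lambda>n. ereal (d n)) \<le> 0" by (simp only: not_less)
      also have "0 < ereal (1/4)" by simp
      finally have "limsup (\<lambda>n. ereal (d n)) < ereal (1/4)" .
      hence "\<forall>\<^sub>F n in sequentially. ereal (d n) < ereal (1/4)" by (rule Limsup_lessD)
      hence "\<forall>\<^sub>\<infinity>n. \<not> d n > 1/4"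
        unfolding cofinite_eq_sequentially by (rule eventually_mono) simp
      thus False using large by (simp add: frequently_def)
    qed
    ultimately show "y \<in> li_yorke luroth x" using elim(3) by (simp add: li_yorke_def d_def)
  qed
qed

text \<open>The complement of the Li-Yorke set in \<open>{0..1}\<close> lies in a Borel null set
  together with the point \<open>0\<close>. Completeness of Lebesgue measure then makes it a
  measurable null set, so measurability of the Li-Yorke set comes for free.\<close>

theorem corollary1p4:
  fixes x :: real
  assumes "x \<in> {0..1}"
  shows "emeasure (lebesgue_on {0..1}) (li_yorke luroth x) = 1"
proof -
  have "AE y in lborel. y \<in> {0<..1} \<longrightarrow> y \<in> li_yorke luroth x"
    using AE_li_yorke_luroth[OF assms] unfolding unit_measure_def
    by (subst (asm) AE_restrict_space_iff) auto
  then obtain Z where Z: "Z \<in> null_sets lborel" "{y. \<not> (y \<in> {0<..1} \<longrightarrow> y \<in> li_yorke luroth x)} \<subseteq> Z"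
    unfolding eventually_ae_filter by auto
  define N where "N = {0..1} - li_yorke luroth x"
  have sub: "li_yorke luroth x \<subseteq> {0..1}" by (auto simp: li_yorke_def)
  have "N \<subseteq> Z \<union> {0}"
  proof
    fix y assume "y \<in> N"
    thus "y \<in> Z \<union> {0}" using Z(2) by (cases "y = 0") (auto simp: N_def)
  qed
  moreover have "Z \<union> {0} \<in> null_sets lebesgue"
    using Z(1) by (intro null_sets_completionI null_sets.Un) auto
  ultimately have N: "N \<in> null_sets lebesgue" by (rule null_sets_completion_subset)
  have "li_yorke luroth x = {0..1} - N" using sub by (auto simp: N_def)
  hence "emeasure lebesgue (li_yorke luroth x) = emeasure lebesgue {0..1::real}"
    using N by (simp add: emeasure_Diff_null_set)
  thus ?thesis using sub by (simp add: emeasure_restrict_space)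
qed

end
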